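(* Let $\mathbf{F}\in\mathbb{R}^{d_x\times N}$ and $\mathbf{G}\in\mathbb{R}^{d_y\times N}$ be data matrices such that $\Sigma_{ff}=\mathbf{F}\mathbf{F}^\top$ and $\Sigma_{gg}=\mathbf{G}\mathbf{G}^\top$ are invertible, and let $1\le L\le\min(d_x,d_y)$. Put $\tilde\Sigma_{fg}=\Sigma_{ff}^{-1/2}\,\mathbf{F}\mathbf{G}^\top\,\Sigma_{gg}^{-1/2}$, with singular values $$\sigma_1\ge\dots\ge\sigma_L>\sigma_{L+1}\ge\dots\ge\sigma_{\min(d_x,d_y)},$$ and let $\tilde{\mathbf{U}}\Lambda\tilde{\mathbf{V}}^\top$ be its rank-$L$ SVD, where $\tilde{\mathbf{U}}\in\mathbb{R}^{d_x\times L}$ and $\tilde{\mathbf{V}}\in\mathbb{R}^{d_y\times L}$ have orthonormal columns (the top-$L$ left and right singular vectors). Let $\tilde{\mathbf{U}}_0\in\mathbb{R}^{d_x\times L}$ satisfy $\tilde{\mathbf{U}}_0^\top\tilde{\mathbf{U}}_0=\mathbf{I}$ and suppose $\tilde{\mathbf{U}}_0^\top\tilde{\mathbf{U}}$ is nonsingular. Run the following iteration (alternating least squares): set $\mathbf{A}_0=\tilde{\mathbf{U}}_0^\top\Sigma_{ff}^{-1/2}\mathbf{F}$, and for $t=1,2,\dots,T$: $$\mathbf{B}_t\leftarrow \mathbf{A}_{t-1}\mathbf{G}^\top(\mathbf{G}\mathbf{G}^\top)^{-1}\mathbf{G},\qquad \mathbf{B}_t\leftarrow(\mathbf{B}_t\mathbf{B}_t^\top)^{-1/2}\mathbf{B}_t,$$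 $$\mathbf{A}_t\leftarrow \mathbf{B}_{t}\mathbf{F}^\top(\mathbf{F}\mathbf{F}^\top)^{-1}\mathbf{F},\qquad \mathbf{A}_t\leftarrow(\mathbf{A}_t\mathbf{A}_t^\top)^{-1/2}\mathbf{A}_t.$$ Then, as $T\to\infty$, the output $(\mathbf{A}_T,\mathbf{B}_T)$ converges to the CCA projections $(\mathbf{U}^\top\mathbf{F},\mathbf{V}^\top\mathbf{G})$, where $\mathbf{U}=\Sigma_{ff}^{-1/2}\tilde{\mathbf{U}}$ and $\mathbf{V}=\Sigma_{gg}^{-1/2}\tilde{\mathbf{V}}$ (convergence being understood as convergence of the $L$-dimensional row space of $\mathbf{A}_T$, resp. $\mathbf{B}_T$, to that of $\mathbf{U}^\top\mathbf{F}$, resp. $\mathbf{V}^\top\mathbf{G}$).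
   Context: Canonical correlation analysis (CCA) of $(\mathbf{F},\mathbf{G})$ seeks $\mathbf{U}\in\mathbb{R}^{d_x\times L}$, $\mathbf{V}\in\mathbb{R}^{d_y\times L}$ maximizing $\mathrm{tr}(\mathbf{U}^\top\mathbf{F}\mathbf{G}^\top\mathbf{V})$ subject to $\mathbf{U}^\top\mathbf{F}\mathbf{F}^\top\mathbf{U}=\mathbf{V}^\top\mathbf{G}\mathbf{G}^\top\mathbf{V}=\mathbf{I}$; an optimum is $\mathbf{U}=\Sigma_{ff}^{-1/2}\tilde{\mathbf{U}}$, $\mathbf{V}=\Sigma_{gg}^{-1/2}\tilde{\mathbf{V}}$, and the matrices $\mathbf{U}^\top\mathbf{F}\in\mathbb{R}^{L\times N}$, $\mathbf{V}^\top\mathbf{G}\in\mathbb{R}^{L\times N}$ are called the CCA projections of view 1 and view 2. Covariances are unnormalized (scaled by $N$). For a matrix $\mathbf{M}$ with full row rank, $(\mathbf{M}\mathbf{M}^\top)^{-1/2}\mathbf{M}$ denotes the whitening of $\mathbf{M}$ (giving a matrix with orthonormal rows spanning the same row space), and $\Sigma^{-1/2}$ is the inverse of the symmetric positive definite square root.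
   Formalization: When L = min(d_x, d_y), where σ_{L+1} does not exist, the formal statement takes σ_{L+1} = 0, i.e. requires σ_L > 0; otherwise B_1 lacks full row rank and its whitening is undefined. *)

theory Defs
  imports "Jordan_Normal_Form.Matrix"
begin

definition mat_inv :: "real mat \<Rightarrow> real mat" where
  "mat_inv A = (THE B. B \<in> carrier_mat (dim_row A) (dim_row A)
                 \<and> A * B = 1\<^sub>m (dim_row A) \<and> B * A = 1\<^sub>m (dim_row A))"

definition spd_mat :: "real mat \<Rightarrow> bool" where
  "spd_mat S \<longleftrightarrow> square_mat S \<and> transpose_mat S = S \<and>
     (\<forall>v \<in> carrier_vec (dim_row S). v \<noteq> 0\<^sub>v (dim_row S) \<longrightarrow> v \<bullet> (S *\<^sub>v v) > 0)"

definition mat_sqrt :: "real mat \<Rightarrow> real mat" where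
  "mat_sqrt M = (THE S. S \<in> carrier_mat (dim_row M) (dim_row M) \<and> spd_mat S \<and> S * S = M)"

definition mat_inv_sqrt :: "real mat \<Rightarrow> real mat" where
  "mat_inv_sqrt M = mat_inv (mat_sqrt M)"

definition whiten :: "real mat \<Rightarrow> real mat" where
  "whiten M = mat_inv_sqrt (M * transpose_mat M) * M"

definition row_proj :: "real mat \<Rightarrow> real mat" where
  "row_proj M = transpose_mat M * mat_inv (M * transpose_mat M) * M"

definition orthonormal_cols :: "real mat \<Rightarrow> bool" where
  "orthonormal_cols M \<longleftrightarrow> transpose_mat M * M = 1\<^sub>m (dim_col M)"

definition first_cols :: "real mat \<Rightarrow> nat \<Rightarrow> real mat" where
  "first_cols M k = mat (dim_row M) k (\<lambda>(i,j). M $$ (i,j))"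

definition rect_diag :: "nat \<Rightarrow> nat \<Rightarrow> (nat \<Rightarrow> real) \<Rightarrow> real mat" where
  "rect_diag m n \<sigma> = mat m n (\<lambda>(i,j). if i = j then \<sigma> i else 0)"

definition mat_tendsto :: "(nat \<Rightarrow> real mat) \<Rightarrow> real mat \<Rightarrow> bool" where
  "mat_tendsto X Y \<longleftrightarrow> (\<forall>i < dim_row Y. \<forall>j < dim_col Y.
       (\<lambda>t. X t $$ (i,j)) \<longlonglongrightarrow> Y $$ (i,j))"

text \<open>The alternating least squares iteration.  A 0 = U0^T Sff^(-1/2) F;
  B (t+1) = whiten (A t G^T (G G^T)^-1 G);  A (t+1) = whiten (B (t+1) F^T (F F^T)^-1 F).
  B 0 is not used by the algorithm (set to A 0 arbitrarily).\<close>
fun als :: "real mat \<Rightarrow> real mat \<Rightarrow> real mat \<Rightarrow> nat \<Rightarrow> real mat \<times> real mat" where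
  "als F G U0 0 =
     (let A0 = transpose_mat U0 * mat_inv_sqrt (F * transpose_mat F) * F in (A0, A0))"
| "als F G U0 (Suc t) =
     (let A = fst (als F G U0 t);
          B' = whiten (A * transpose_mat G * mat_inv (G * transpose_mat G) * G);
          A' = whiten (B' * transpose_mat F * mat_inv (F * transpose_mat F) * F)
      in (A', B'))"

end

theory Submission
  imports Defs "Jordan_Normal_Form.Spectral_Radius"
begin

text \<open>
  Whitening multiplies a matrix from the left by an invertible matrix, and \<open>row_proj\<close> does not see
  such factors. With the orthonormal-row matrices \<open>X = \<Sigma>\<^sub>f\<^sub>f\<^sup>-\<^sup>1\<^sup>/\<^sup>2 F\<close>, \<open>Y = \<Sigma>\<^sub>g\<^sub>g\<^sup>-\<^sup>1\<^sup>/\<^sup>2 G\<close> and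
  \<open>S = X Y\<^sup>T = P D Q\<^sup>T\<close>, the row spaces of \<open>A\<^sub>t\<close> and \<open>B\<^sub>t\<^sub>+\<^sub>1\<close> are therefore those of
  \<open>U\<^sub>0\<^sup>T (S S\<^sup>T)\<^sup>t X\<close> and \<open>U\<^sub>0\<^sup>T (S S\<^sup>T)\<^sup>t S Y\<close>: orthogonal iteration for \<open>S S\<^sup>T\<close>. Normalising the
  component along the top \<open>L\<close> singular vectors to the identity replaces \<open>U\<^sub>0\<^sup>T (S S\<^sup>T)\<^sup>t\<close> by matrices
  \<open>W\<^sub>t\<close> whose remaining coordinates carry factors \<open>(\<sigma>\<^sub>j / \<sigma>\<^sub>i)\<^sup>2\<^sup>t\<close> with \<open>i < L \<le> j\<close> and so tend to \<open>0\<close>.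
  The claim follows since \<open>row_proj\<close> is continuous at matrices of full row rank. The inverse square
  roots are meaningful because a positive definite matrix has exactly one positive definite square
  root, by the real spectral theorem.
\<close>

subsection \<open>The real spectral theorem\<close>

text \<open>Premises on dimensions instead of carrier sets let the simplifier reassociate long
  products: no intermediate dimension has to be guessed by unification.\<close>

lemma mat_assoc:
  assumes "dim_col A = dim_row B" "dim_col B = dim_row C"
  shows "A * B * C = A * (B * (C :: 'a :: semiring_0 mat))"
  by (rule assoc_mult_mat; rule carrier_matI; fact assms refl)

lemma mat_vec_assoc:
  assumes "dim_col A = dim_row B" "dim_col B = dim_vec v"
  shows "A * B *\<^sub>v v = A *\<^sub>v (B *\<^sub>v (v :: 'a :: comm_semiring_0 vec))"
  by (rule assoc_mult_mat_vec; (rule carrier_matI carrier_vecI); fact assms refl assms(2)[symmetric])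

lemma transpose_mult_dims:
  assumes "dim_col A = dim_row B"
  shows "(A * B)\<^sup>T = B\<^sup>T * (A :: 'a :: comm_semiring_0 mat)\<^sup>T"
  by (rule transpose_mult; rule carrier_matI; fact assms refl)

lemma scalar_prod_self_nonneg: "0 \<le> v \<bullet> (v :: real vec)"
  by (auto simp: scalar_prod_def intro: sum_nonneg)

lemma scalar_prod_self_eq_0:
  assumes "v \<in> carrier_vec n" "v \<bullet> (v :: real vec) = 0"
  shows "v = 0\<^sub>v n"
  using assms by (intro eq_vecI) (auto simp: scalar_prod_def sum_nonneg_eq_0_iff)

lemma mult_mat_zero_vec: "A \<in> carrier_mat n m \<Longrightarrow> A *\<^sub>v 0\<^sub>v m = 0\<^sub>v n"
  by (intro eq_vecI) auto

text \<open>Over the complex numbers an eigenvector \<open>z = x + i y\<close> exists. Splitting its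
  equation into real and imaginary parts and using symmetry shows that the eigenvalue is real, so
  \<open>x\<close> and \<open>y\<close> both satisfy the real equation, and one of them is
  nonzero.\<close>

lemma symmetric_real_eigenvector:
  fixes A :: "real mat"
  assumes A: "A \<in> carrier_mat n n" and sym: "A\<^sup>T = A" and n: "n > 0"
  obtains v e where "v \<in> carrier_vec n" "v \<noteq> 0\<^sub>v n" "A *\<^sub>v v = e \<cdot>\<^sub>v v"
proof -
  let ?B = "map_mat complex_of_real A"
  have B: "?B \<in> carrier_mat n n" using A by simp
  obtain e where "eigenvalue ?B e"
    using spectrum_non_empty[OF B n] unfolding spectrum_def by auto
  then obtain z where z: "z \<in> carrier_vec n" "z \<noteq> 0\<^sub>v n" "?B *\<^sub>v z = e \<cdot>\<^sub>v z"
    using A unfolding eigenvalue_def eigenvector_def by auto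
  define x where "x = map_vec Re z"
  define y where "y = map_vec Im z"
  have [simp]: "dim_vec x = n" "dim_vec y = n" "dim_row A = n" "dim_col A = n" "dim_vec z = n"
    using z A by (auto simp: x_def y_def)
  have xy: "x \<in> carrier_vec n" "y \<in> carrier_vec n" by (auto intro: carrier_vecI)
  have entry: "(\<Sum>j\<in>{0..<n}. complex_of_real (A $$ (i,j)) * z $ j) = e * z $ i" if "i < n" for i
    using arg_cong[OF z(3), of "\<lambda>w. w $ i"] that by (simp add: scalar_prod_def)
  have Ax: "A *\<^sub>v x = Re e \<cdot>\<^sub>v x - Im e \<cdot>\<^sub>v y"
  proof (rule eq_vecI)
    fix i assume "i < dim_vec (Re e \<cdot>\<^sub>v x - Im e \<cdot>\<^sub>v y)"
    then have "i < n" by simp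
    then show "(A *\<^sub>v x) $ i = (Re e \<cdot>\<^sub>v x - Im e \<cdot>\<^sub>v y) $ i"
      using arg_cong[OF entry, of i Re] by (simp add: scalar_prod_def x_def y_def)
  qed simp
  have Ay: "A *\<^sub>v y = Im e \<cdot>\<^sub>v x + Re e \<cdot>\<^sub>v y"
  proof (rule eq_vecI)
    fix i assume "i < dim_vec (Im e \<cdot>\<^sub>v x + Re e \<cdot>\<^sub>v y)"
    then have "i < n" by simp
    then show "(A *\<^sub>v y) $ i = (Im e \<cdot>\<^sub>v x + Re e \<cdot>\<^sub>v y) $ i"
      using arg_cong[OF entry, of i Im] by (simp add: scalar_prod_def x_def y_def)
  qed simp
  \<comment> \<open>Both sides are expanded below: the \<open>Re e\<close> terms cancel and
    \<open>Im e\<close> times the squared norm of \<open>z\<close> remains.\<close>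
  have "(A *\<^sub>v y) \<bullet> x = y \<bullet> (A *\<^sub>v x)"
    using transpose_vec_mult_scalar[OF A xy] sym by simp
  moreover have "(A *\<^sub>v y) \<bullet> x = Im e * (x \<bullet> x) + Re e * (x \<bullet> y)"
    unfolding Ay using xy
    by (simp add: add_scalar_prod_distrib[of _ n] comm_scalar_prod[of y n x])
  moreover have "y \<bullet> (A *\<^sub>v x) = Re e * (x \<bullet> y) - Im e * (y \<bullet> y)"
    unfolding Ax using xy
    by (simp add: scalar_prod_minus_distrib[of _ n] comm_scalar_prod[of y n x])
  ultimately have "Im e * (x \<bullet> x + y \<bullet> y) = 0" by (simp add: algebra_simps)
  moreover have "x \<noteq> 0\<^sub>v n \<or> y \<noteq> 0\<^sub>v n"
  proof (rule ccontr)
    assume "\<not> (x \<noteq> 0\<^sub>v n \<or> y \<noteq> 0\<^sub>v n)"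
    then have "x $ i = 0" "y $ i = 0" if "i < n" for i using that by auto
    then have "z = 0\<^sub>v n" by (intro eq_vecI) (auto simp: x_def y_def complex_eq_iff)
    with z show False by simp
  qed
  moreover from this have "x \<bullet> x + y \<bullet> y \<noteq> 0"
    using scalar_prod_self_eq_0[OF xy(1)] scalar_prod_self_eq_0[OF xy(2)]
      scalar_prod_self_nonneg[of x] scalar_prod_self_nonneg[of y] by linarith
  ultimately have "Im e = 0" by simp
  then have "A *\<^sub>v x = Re e \<cdot>\<^sub>v x" "A *\<^sub>v y = Re e \<cdot>\<^sub>v y"
    unfolding Ax Ay using xy by (auto intro!: eq_vecI)
  with \<open>x \<noteq> 0\<^sub>v n \<or> y \<noteq> 0\<^sub>v n\<close> xy that show thesis by blast
qed

text \<open>Gram-Schmidt keeps the head of the list it is applied to, so a basis starting with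
  \<open>v\<close> becomes an orthogonal one starting with \<open>v\<close>. Normalising the columns
  changes the first one only by the factor \<open>c\<close>.\<close>

lemma orthonormal_completion:
  fixes v :: "real vec"
  assumes v: "v \<in> carrier_vec n" "v \<noteq> 0\<^sub>v n"
  obtains W c where "W \<in> carrier_mat n n" "W\<^sup>T * W = 1\<^sub>m n" "col W 0 = c \<cdot>\<^sub>v v"
proof -
  interpret cof_vec_space n "TYPE(real)" .
  have n: "n > 0" using v by (cases n) auto
  note bc = basis_completion[OF v]
  obtain vs where vs: "basis_completion v = v # vs"
    using bc(6,7) n by (cases "basis_completion v") auto
  define ws where "ws = gram_schmidt n (basis_completion v)"
  have ws: "set ws \<subseteq> carrier_vec n" "corthogonal ws" "length ws = n"
    using gram_schmidt_result[OF bc(2,4,5) refl] bc(6) by (auto simp: ws_def)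
  have hd: "hd ws = v" using gram_schmidt_hd[OF v(1), of vs] vs by (simp add: ws_def)
  have ws0: "ws ! 0 = v" using hd ws(3) n by (cases ws) auto
  have wsc [simp]: "ws ! i \<in> carrier_vec n" "dim_vec (ws ! i) = n" if "i < n" for i
    using ws that nth_mem[of i ws] by (force, metis carrier_vecD nth_mem subsetD)
  \<comment> \<open>Gram-Schmidt is stated for the conjugate inner product, which over the reals is
    the ordinary one.\<close>
  have conj: "conjugate w = w" for w :: "real vec" by (rule eq_vecI) auto
  have orth: "(ws ! i \<bullet> ws ! j = 0) = (i \<noteq> j)" if "i < n" "j < n" for i j
    using corthogonalD[OF ws(2)] that ws(3) conj by simp
  define r where "r j = 1 / sqrt (ws ! j \<bullet> ws ! j)" for j
  define W where "W = mat n n (\<lambda>(i,j). r j * ws ! j $ i)"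
  have W: "W \<in> carrier_mat n n" by (simp add: W_def)
  have col: "col W j = r j \<cdot>\<^sub>v ws ! j" if "j < n" for j
    using that by (intro eq_vecI) (auto simp: W_def)
  have "W\<^sup>T * W = 1\<^sub>m n"
  proof (rule eq_matI)
    fix i j assume "i < dim_row (1\<^sub>m n :: real mat)" "j < dim_col (1\<^sub>m n :: real mat)"
    then have ij: "i < n" "j < n" by auto
    have "(W\<^sup>T * W) $$ (i,j) = r i * (r j * (ws ! i \<bullet> ws ! j))"
      using ij W by (simp add: col)
    also have "\<dots> = 1\<^sub>m n $$ (i,j)"
    proof (cases "i = j")
      case True
      then have "ws ! i \<bullet> ws ! i > 0"
        using orth[OF ij(1,1)] scalar_prod_self_nonneg[of "ws ! i"] by linarith
      then show ?thesis using True ij by (simp add: r_def field_simps)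
    qed (use ij orth in auto)
    finally show "(W\<^sup>T * W) $$ (i,j) = 1\<^sub>m n $$ (i,j)" .
  qed (use W in auto)
  moreover have "col W 0 = r 0 \<cdot>\<^sub>v v" using col[OF n] ws0 by simp
  ultimately show thesis using that W by blast
qed

lemma mult_block_diag_mat:
  assumes "A \<in> carrier_mat n n" "A' \<in> carrier_mat n n" "B \<in> carrier_mat m m" "B' \<in> carrier_mat m m"
  shows "four_block_mat A (0\<^sub>m n m) (0\<^sub>m m n) B * four_block_mat A' (0\<^sub>m n m) (0\<^sub>m m n) B'
    = four_block_mat (A * A') (0\<^sub>m n m) (0\<^sub>m m n) (B * (B' :: real mat))"
proof -
  have "A * A' \<in> carrier_mat n n" "B * B' \<in> carrier_mat m m" using assms by auto
  with assms show ?thesis by (subst mult_four_block_mat[of _ n n _ m _ m _ _ n _ m]) auto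
qed

text \<open>Deflation: conjugating by an orthogonal \<open>W\<close> whose first column is an
  eigenvector splits off a one-by-one block, and the induction hypothesis diagonalises the symmetric
  remainder \<open>C\<close>.\<close>

lemma symmetric_real_diagonalisable:
  fixes A :: "real mat"
  assumes "A \<in> carrier_mat n n" "A\<^sup>T = A"
  obtains U d where "U \<in> carrier_mat n n" "U\<^sup>T * U = 1\<^sub>m n" "U * U\<^sup>T = 1\<^sub>m n"
    "A = U * mat_diag n d * U\<^sup>T"
proof -
  have "\<exists>U d. U \<in> carrier_mat n n \<and> U\<^sup>T * U = 1\<^sub>m n \<and> A = U * mat_diag n d * U\<^sup>T"
    using assms
  proof (induction n arbitrary: A)
    case 0
    then show ?case by (intro exI[of _ "1\<^sub>m 0"] exI[of _ "\<lambda>_. 0"]) (auto intro!: eq_matI)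
  next
    case (Suc n)
    obtain v e where v: "v \<in> carrier_vec (Suc n)" "v \<noteq> 0\<^sub>v (Suc n)" "A *\<^sub>v v = e \<cdot>\<^sub>v v"
      using symmetric_real_eigenvector[OF Suc.prems] by blast
    obtain W c where W: "W \<in> carrier_mat (Suc n) (Suc n)" "W\<^sup>T * W = 1\<^sub>m (Suc n)" "col W 0 = c \<cdot>\<^sub>v v"
      using orthonormal_completion[OF v(1,2)] by blast
    have W': "W * W\<^sup>T = 1\<^sub>m (Suc n)"
      by (rule mat_mult_left_right_inverse[OF _ W(1,2)]) (use W in auto)
    note A = Suc.prems(1)
    note dims [simp] = carrier_matD[OF A] carrier_matD[OF W(1)]
    define B where "B = W\<^sup>T * A * W"
    have B: "B \<in> carrier_mat (Suc n) (Suc n)" by (auto simp: B_def intro: carrier_matI)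
    have Bsym: "B\<^sup>T = B" by (simp add: B_def transpose_mult_dims Suc.prems(2) mat_assoc)
    \<comment> \<open>The first column of \<open>A * W\<close> is \<open>e\<close> times that of
      \<open>W\<close>, so the first column of \<open>B\<close> is \<open>e\<close> times that of
      the identity.\<close>
    have B0: "B $$ (i, 0) = (if i = 0 then e else 0)" if "i < Suc n" for i
    proof -
      have "col (A * W) 0 = A *\<^sub>v col W 0" by (rule eq_vecI) auto
      also have "\<dots> = e \<cdot>\<^sub>v col W 0"
        unfolding W(3) using v by (simp add: mult_mat_vec[OF A] smult_smult_assoc mult.commute)
      finally have "B $$ (i, 0) = col W i \<bullet> (e \<cdot>\<^sub>v col W 0)"
        using that by (simp add: B_def mat_assoc)
      also have "\<dots> = e * (W\<^sup>T * W) $$ (i, 0)" using that by simp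
      finally show ?thesis using that by (simp add: W(2))
    qed
    define C where "C = mat n n (\<lambda>(i,j). B $$ (Suc i, Suc j))"
    have C: "C \<in> carrier_mat n n" by (simp add: C_def)
    have swap: "B $$ (i,j) = B $$ (j,i)" if "i < Suc n" "j < Suc n" for i j
      using arg_cong[OF Bsym, of "\<lambda>M. M $$ (i,j)"] that B by auto
    have "C\<^sup>T = C" by (rule eq_matI) (auto simp: C_def swap)
    from Suc.IH[OF C this] obtain U d where U: "U \<in> carrier_mat n n" "U\<^sup>T * U = 1\<^sub>m n"
      and Cd: "C = U * mat_diag n d * U\<^sup>T" by blast
    \<comment> \<open>Bordering the eigenbasis of \<open>C\<close> by a unit block leaves the first
      coordinate alone; accordingly \<open>d'\<close> puts the split-off eigenvalue \<open>e\<close>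
      in front of \<open>d\<close>.\<close>
    define V where "V = four_block_mat (1\<^sub>m 1) (0\<^sub>m 1 n) (0\<^sub>m n 1) U"
    define d' where "d' i = (case i of 0 \<Rightarrow> e | Suc j \<Rightarrow> d j)" for i
    have V: "V \<in> carrier_mat (Suc n) (Suc n)" 
      using four_block_carrier_mat[of "1\<^sub>m 1" 1 1 U n n] U(1) by (simp add: V_def)
    have VT: "V\<^sup>T = four_block_mat (1\<^sub>m 1) (0\<^sub>m 1 n) (0\<^sub>m n 1) (U\<^sup>T)"
      unfolding V_def by (subst transpose_four_block_mat[of _ 1 1 _ n _ n]) (use U in auto)
    have D: "mat_diag (Suc n) d' = four_block_mat (mat_diag 1 (\<lambda>_. e)) (0\<^sub>m 1 n) (0\<^sub>m n 1) (mat_diag n d)"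
      by (rule eq_matI) (auto simp: mat_diag_def d'_def split: nat.splits)
    have BB: "B = four_block_mat (mat_diag 1 (\<lambda>_. e)) (0\<^sub>m 1 n) (0\<^sub>m n 1) C"
      by (rule eq_matI) (use B in \<open>auto simp: mat_diag_def C_def B0 swap[of 0]\<close>)
    have VV: "V\<^sup>T * V = 1\<^sub>m (Suc n)"
      unfolding VT unfolding V_def
      using U by (simp add: mult_block_diag_mat plus_1_eq_Suc del: One_nat_def)
    have BV: "B = V * mat_diag (Suc n) d' * V\<^sup>T"
    proof -
      have "U * mat_diag n d \<in> carrier_mat n n" "1\<^sub>m 1 * mat_diag 1 (\<lambda>_. e) = mat_diag 1 (\<lambda>_. e)"
        "mat_diag 1 (\<lambda>_. e) * 1\<^sub>m 1 = mat_diag 1 (\<lambda>_. e)"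
        using U mat_diag_dim[of 1 "\<lambda>_. e"] mat_diag_dim[of n d] by (auto simp del: One_nat_def mat_diag_dim)
      then show ?thesis
        unfolding VT D BB unfolding V_def using U(1) Cd
        by (simp add: mult_block_diag_mat plus_1_eq_Suc del: One_nat_def)
    qed
    have "W * V \<in> carrier_mat (Suc n) (Suc n)" using W V by auto
    moreover note dims' [simp] = carrier_matD[OF V] 
    have "(W * V)\<^sup>T * (W * V) = V\<^sup>T * (W\<^sup>T * W) * V" by (simp add: transpose_mult_dims mat_assoc)
    then have "(W * V)\<^sup>T * (W * V) = 1\<^sub>m (Suc n)" using V by (simp add: W(2) VV)
    moreover have "A = W * V * mat_diag (Suc n) d' * (W * V)\<^sup>T"
    proof -
      have "W * V * mat_diag (Suc n) d' * (W * V)\<^sup>T = W * B * W\<^sup>T"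
        unfolding BV by (simp add: transpose_mult_dims mat_assoc mat_diag_def)
      also have "\<dots> = (W * W\<^sup>T) * A * (W * W\<^sup>T)" by (simp add: B_def mat_assoc)
      finally show ?thesis using A W' by simp
    qed
    ultimately show ?case by blast
  qed
  then obtain U d where U: "U \<in> carrier_mat n n" "U\<^sup>T * U = 1\<^sub>m n" "A = U * mat_diag n d * U\<^sup>T"
    by blast
  moreover have "U * U\<^sup>T = 1\<^sub>m n"
    by (rule mat_mult_left_right_inverse[OF _ U(1,2)]) (use U in auto)
  ultimately show thesis using that by blast
qed


subsection \<open>Inverses and square roots\<close>

text \<open>For square matrices a right inverse is also a left inverse, so one equation is enough to
  evaluate the description in \<open>mat_inv\<close>.\<close>

lemma mat_invI:
  assumes A: "A \<in> carrier_mat n n" and B: "B \<in> carrier_mat n n" and AB: "A * B = 1\<^sub>m n"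
  shows "mat_inv A = B"
  unfolding mat_inv_def
proof (rule the_equality)
  show "B \<in> carrier_mat (dim_row A) (dim_row A) \<and> A * B = 1\<^sub>m (dim_row A) \<and> B * A = 1\<^sub>m (dim_row A)"
    using A B AB mat_mult_left_right_inverse[OF A B AB] by simp
next
  fix C assume "C \<in> carrier_mat (dim_row A) (dim_row A) \<and> A * C = 1\<^sub>m (dim_row A) \<and> C * A = 1\<^sub>m (dim_row A)"
  then have C: "C \<in> carrier_mat n n" "C * A = 1\<^sub>m n" using A by auto
  have "C = C * (A * B)" using C by (simp add: AB)
  also have "\<dots> = (C * A) * B" using A B C(1) by (simp add: mat_assoc)
  also have "\<dots> = B" using B by (simp add: C)
  finally show "C = B" .
qed

text \<open>The adjugate formula makes the entries of the inverse rational functions of the entries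
  of \<open>A\<close>; this is the source of continuity in
  \<open>mat_tendsto_mat_inv\<close>.\<close>

lemma
  assumes A: "A \<in> carrier_mat n n" and det: "det A \<noteq> 0"
  shows mat_inv_adj: "mat_inv A = (1 / det A) \<cdot>\<^sub>m adj_mat A"
    and mat_inv_carrier: "mat_inv A \<in> carrier_mat n n"
    and mat_inv_right: "A * mat_inv A = 1\<^sub>m n"
    and mat_inv_left: "mat_inv A * A = 1\<^sub>m n"
proof -
  let ?B = "(1 / det A) \<cdot>\<^sub>m adj_mat A"
  have B: "?B \<in> carrier_mat n n" using adj_mat(1)[OF A] by simp
  have "A * ?B = 1\<^sub>m n"
    using mult_smult_distrib[OF A adj_mat(1)[OF A]] adj_mat(2)[OF A] det
    by (auto intro!: eq_matI)
  from mat_invI[OF A B this] this mat_mult_left_right_inverse[OF A B this] B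
  show "mat_inv A = ?B" "mat_inv A \<in> carrier_mat n n" "A * mat_inv A = 1\<^sub>m n" "mat_inv A * A = 1\<^sub>m n"
    by simp_all
qed

lemma invertible_mat_det_nonzero:
  assumes A: "A \<in> carrier_mat n n" and inv: "invertible_mat (A :: real mat)"
  shows "det A \<noteq> 0"
proof -
  obtain B where B: "A * B = 1\<^sub>m n" "B * A = 1\<^sub>m (dim_row B)"
    using inv A unfolding invertible_mat_def inverts_mat_def by auto
  have "dim_row B = n" using arg_cong[OF B(2), of dim_col] A by simp
  moreover have "dim_col B = n" using arg_cong[OF B(1), of dim_col] by simp
  ultimately have "B \<in> carrier_mat n n" by auto
  from det_mult[OF A this] B(1) show ?thesis by auto
qed

section \<open>Gram matrices and positive definite square roots\<close>

lemma transpose_mult_vec_norm: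
  assumes "M \<in> carrier_mat n m" "v \<in> carrier_vec n"
  shows "v \<bullet> (M * M\<^sup>T *\<^sub>v v) = (M\<^sup>T *\<^sub>v v) \<bullet> (M\<^sup>T *\<^sub>v (v :: real vec))"
proof -
  have "v \<bullet> (M *\<^sub>v (M\<^sup>T *\<^sub>v v)) = (M\<^sup>T *\<^sub>v v) \<bullet> (M\<^sup>T *\<^sub>v v)"
    using transpose_vec_mult_scalar[of M n m "M\<^sup>T *\<^sub>v v" v] assms by simp
  then show ?thesis using assms by (simp add: mat_vec_assoc)
qed

text \<open>The factor \<open>J\<close> certifies full row rank. A kernel vector \<open>v\<close> of
  the Gram matrix satisfies \<open>M\<^sup>T *\<^sub>v v = 0\<close> because the square of that norm
  vanishes, and then \<open>v\<close> is also killed by the transpose of the nonsingular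
  \<open>M * J\<close>.\<close>

lemma det_gram_nonzero:
  assumes M: "M \<in> carrier_mat n m" and J: "J \<in> carrier_mat m n" and det: "det (M * J) \<noteq> (0 :: real)"
  shows "det (M * M\<^sup>T) \<noteq> 0"
proof
  assume "det (M * M\<^sup>T) = 0"
  then obtain v where v: "v \<in> carrier_vec n" "v \<noteq> 0\<^sub>v n" "M * M\<^sup>T *\<^sub>v v = 0\<^sub>v n"
    using det_0_iff_vec_prod_zero[of "M * M\<^sup>T" n] M by auto
  have "M\<^sup>T *\<^sub>v v = 0\<^sub>v m"
    using transpose_mult_vec_norm[OF M v(1)] v M
    by (intro scalar_prod_self_eq_0) (auto simp: mult_mat_vec_carrier[of _ m n])
  then have "(M * J)\<^sup>T *\<^sub>v v = 0\<^sub>v n"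
    using M J v by (simp add: transpose_mult_dims mat_vec_assoc mult_mat_zero_vec[of _ n m])
  then have "det ((M * J)\<^sup>T) = 0"
    using det_0_iff_vec_prod_zero[of "(M * J)\<^sup>T" n] M J v by auto
  then show False using det_transpose[of "M * J" n] det M J by simp
qed

lemma spd_mat_gram:
  assumes M: "M \<in> carrier_mat n m" and det: "det (M * M\<^sup>T) \<noteq> 0"
  shows "spd_mat (M * M\<^sup>T)"
  unfolding spd_mat_def
proof (intro conjI ballI impI)
  show "square_mat (M * M\<^sup>T)" "(M * M\<^sup>T)\<^sup>T = M * M\<^sup>T"
    using M by (simp_all add: transpose_mult_dims)
  fix v :: "real vec" assume "v \<in> carrier_vec (dim_row (M * M\<^sup>T))" "v \<noteq> 0\<^sub>v (dim_row (M * M\<^sup>T))"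
  then have v: "v \<in> carrier_vec n" "v \<noteq> 0\<^sub>v n" using M by auto
  have "M * M\<^sup>T *\<^sub>v v \<noteq> 0\<^sub>v n"
    using det det_0_iff_vec_prod_zero[of "M * M\<^sup>T" n] v M by auto
  then have "M\<^sup>T *\<^sub>v v \<noteq> 0\<^sub>v m" using M v by (auto simp: mat_vec_assoc)
  then have "(M\<^sup>T *\<^sub>v v) \<bullet> (M\<^sup>T *\<^sub>v v) \<noteq> 0"
    using scalar_prod_self_eq_0[of "M\<^sup>T *\<^sub>v v" m] M v by (auto simp: mult_mat_vec_carrier[of _ m n])
  then show "v \<bullet> (M * M\<^sup>T *\<^sub>v v) > 0"
    using transpose_mult_vec_norm[OF M v(1)] scalar_prod_self_nonneg[of "M\<^sup>T *\<^sub>v v"] by simp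
qed

lemma spd_mat_det_nonzero:
  assumes S: "S \<in> carrier_mat n n" and spd: "spd_mat S"
  shows "det S \<noteq> 0"
proof
  assume "det S = 0"
  then obtain v where v: "v \<in> carrier_vec n" "v \<noteq> 0\<^sub>v n" "S *\<^sub>v v = 0\<^sub>v n"
    using det_0_iff_vec_prod_zero[OF S] by auto
  then have "v \<bullet> (S *\<^sub>v v) > 0" using spd S unfolding spd_mat_def by auto
  with v show False by simp
qed

text \<open>For \<open>E = S - T\<close> one has \<open>S E + E T = 0\<close>, so \<open>tr (E S E) + tr (E T E) = 0\<close> where both traces are
  sums of values of positive definite forms at the columns of \<open>E\<close>.\<close>

lemma spd_sqrt_unique:
  assumes S: "S \<in> carrier_mat n n" "spd_mat S" and T: "T \<in> carrier_mat n n" "spd_mat T"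
    and eq: "S * S = T * T"
  shows "S = T"
proof -
  define E where "E = S - T"
  have E: "E \<in> carrier_mat n n" using S T by (auto simp: E_def)
  note dims = carrier_matD[OF S(1)] carrier_matD[OF T(1)] carrier_matD[OF E]
  have sym: "S\<^sup>T = S" "T\<^sup>T = T" using S T by (auto simp: spd_mat_def)
  have ES: "E\<^sup>T = E" unfolding E_def using S T by (simp add: transpose_minus[of _ n n] sym)
  define q where "q M i = col E i \<bullet> (M *\<^sub>v col E i)" for M i
  have q: "(E * (M * E)) $$ (i, i) = q M i" if "M \<in> carrier_mat n n" "i < n" for M i
  proof -
    have "(E * (M * E)) $$ (i, i) = row E i \<bullet> col (M * E) i" using that dims by simp
    also have "row E i = col E i" using that dims ES by (metis row_transpose)
    also have "col (M * E) i = M *\<^sub>v col E i" using that dims by (intro eq_vecI) auto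
    finally show ?thesis by (simp add: q_def)
  qed
  \<comment> \<open>Definiteness makes each value nonnegative and zero only at a zero column, so a
    vanishing sum of these values forces \<open>E\<close> to be zero.\<close>
  have q_pos: "q M i \<ge> 0 \<and> (q M i = 0 \<longrightarrow> col E i = 0\<^sub>v n)"
    if "M \<in> carrier_mat n n" "spd_mat M" "i < n" for M i
    using that E unfolding q_def spd_mat_def
    by (cases "col E i = 0\<^sub>v n") (auto intro!: less_imp_le dest!: bspec[of _ _ "col E i"])
  have "S * E + E * T = S * S - S * T + (S * T - T * T)"
    unfolding E_def using S T
    by (simp add: mult_minus_distrib_mat[of _ n n _ n] minus_mult_distrib_mat[of _ n n _ _ n])
  also have "\<dots> = 0\<^sub>m n n" unfolding eq using S T by (intro eq_matI) auto
  finally have SE: "S * E + E * T = 0\<^sub>m n n" .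
  \<comment> \<open>Cyclicity of the trace moves \<open>T\<close> from the right end of
    \<open>E * (E * T)\<close> to between the two factors \<open>E\<close>.\<close>
  have tr: "(\<Sum>i<n. (A * B) $$ (i,i)) = (\<Sum>i<n. (B * A) $$ (i,i))"
    if "A \<in> carrier_mat n n" "B \<in> carrier_mat n n" for A B :: "real mat"
    using that by (simp add: scalar_prod_def) (subst sum.swap, simp add: mult.commute atLeast0LessThan)
  have "E * (S * E) + E * (E * T) = E * (S * E + E * T)"
    using E S T by (intro mult_add_distrib_mat[symmetric, of _ n n _ n]) auto
  then have "E * (S * E) + E * (E * T) = 0\<^sub>m n n" using E by (simp add: SE)
  then have "(\<Sum>i<n. (E * (S * E)) $$ (i,i) + (E * (E * T)) $$ (i,i)) = 0"
    using dims by (intro sum.neutral ballI) (metis (no_types, lifting) index_add_mat(1) index_mult_mat(2,3) index_zero_mat(1) lessThan_iff)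
  moreover have "(\<Sum>i<n. (E * (E * T)) $$ (i,i)) = (\<Sum>i<n. (E * (T * E)) $$ (i,i))"
    using tr[of E "E * T"] E T dims by (simp add: mat_assoc)
  ultimately have "(\<Sum>i<n. q S i + q T i) = 0"
    using q S T by (simp add: sum.distrib)
  then have "q S i + q T i = 0" if "i < n" for i
    using q_pos[OF S] q_pos[OF T] that by (subst (asm) sum_nonneg_eq_0_iff) (auto intro!: add_nonneg_nonneg)
  then have "col E i = 0\<^sub>v n" if "i < n" for i
    using q_pos[OF S] q_pos[OF T] that by (smt (verit))
  then have zero: "E $$ (i,j) = 0" if "i < n" "j < n" for i j
    using that dims by (metis index_col index_zero_vec(1))
  show ?thesis
  proof (rule eq_matI)
    fix i j assume "i < dim_row T" "j < dim_col T"
    then show "S $$ (i,j) = T $$ (i,j)" using zero[of i j] dims by (simp add: E_def)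
  qed (use dims in auto)
qed

text \<open>In an orthonormal eigenbasis the eigenvalues are positive, so their square roots can be
  taken on the diagonal.\<close>

lemma spd_sqrt_exists:
  assumes M: "M \<in> carrier_mat n n" and spd: "spd_mat M"
  obtains S where "S \<in> carrier_mat n n" "spd_mat S" "S * S = M"
proof -
  have "M\<^sup>T = M" using spd by (simp add: spd_mat_def)
  then obtain U d where U: "U \<in> carrier_mat n n" "U\<^sup>T * U = 1\<^sub>m n" "U * U\<^sup>T = 1\<^sub>m n"
    and MU: "M = U * mat_diag n d * U\<^sup>T"
    using symmetric_real_diagonalisable[OF M] by metis
  note dims [simp] = carrier_matD[OF U(1)] carrier_matD[OF mat_diag_dim]
  \<comment> \<open>The form of \<open>M\<close> is tested at the \<open>i\<close>-th column of
    \<open>U\<close>, where its value is \<open>d i\<close>.\<close>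
  have d_pos: "d i > 0" if i: "i < n" for i
  proof -
    let ?e = "unit_vec n i :: real vec"
    define v where "v = U *\<^sub>v ?e"
    have v: "v \<in> carrier_vec n" using U by (simp add: v_def)
    have "U\<^sup>T *\<^sub>v v = (U\<^sup>T * U) *\<^sub>v ?e" by (simp add: v_def mat_vec_assoc)
    then have UTv: "U\<^sup>T *\<^sub>v v = ?e" by (simp add: U(2))
    have "v \<noteq> 0\<^sub>v n"
    proof
      assume "v = 0\<^sub>v n"
      then have "?e = 0\<^sub>v n" using UTv U by (simp add: mult_mat_zero_vec[of _ n n])
      then show False using i by (metis index_unit_vec(2) index_zero_vec(1) zero_neq_one)
    qed
    then have "0 < v \<bullet> (M *\<^sub>v v)" using spd v M unfolding spd_mat_def by auto
    also have "M *\<^sub>v v = U *\<^sub>v (mat_diag n d *\<^sub>v ?e)"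
      using v by (simp add: MU mat_vec_assoc UTv)
    also have "v \<bullet> (U *\<^sub>v (mat_diag n d *\<^sub>v ?e)) = ?e \<bullet> (mat_diag n d *\<^sub>v ?e)"
      using transpose_vec_mult_scalar[OF U(1) _ v, of "mat_diag n d *\<^sub>v ?e"]
        transpose_vec_mult_scalar[of "U\<^sup>T" n n v "mat_diag n d *\<^sub>v ?e"] U v UTv
        mult_mat_vec_carrier[OF mat_diag_dim, of ?e n d]
      by simp
    also have "\<dots> = d i"
      using i mult_mat_vec_carrier[OF mat_diag_dim, of ?e n d]
      by (simp add: scalar_prod_left_unit scalar_prod_right_unit) (simp add: mat_diag_def)
    finally show ?thesis .
  qed
  \<comment> \<open>A fourth root of \<open>M\<close> exhibits the square root as a Gram matrix, hence as positive definite.\<close>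
  define h where "h = mat_diag n (\<lambda>i. sqrt (sqrt (d i)))"
  have h: "h \<in> carrier_mat n n" "h\<^sup>T = h" by (auto simp: h_def mat_diag_def intro!: eq_matI)
  note [simp] = carrier_matD[OF h(1)]
  define R where "R = U * h"
  have R: "R \<in> carrier_mat n n" using U h by (simp add: R_def)
  have hh: "h * h * (h * h) = mat_diag n d"
    unfolding h_def mat_diag_diag
    by (rule eq_matI) (use d_pos in \<open>auto simp: mat_diag_def real_sqrt_mult[symmetric] abs_of_pos\<close>)
  have RR: "R * R\<^sup>T = U * (h * h) * U\<^sup>T" by (simp add: R_def transpose_mult_dims h mat_assoc)
  have "R * R\<^sup>T * (R * R\<^sup>T) = U * (h * h) * (U\<^sup>T * U) * (h * h) * U\<^sup>T"
    unfolding RR by (simp add: mat_assoc)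
  also have "\<dots> = U * (h * h * (h * h)) * U\<^sup>T"
    using U h by (simp add: U(2) mat_assoc)
  finally have sq: "R * R\<^sup>T * (R * R\<^sup>T) = M" by (simp add: hh MU)
  have RRc: "R * R\<^sup>T \<in> carrier_mat n n" using R by simp
  \<comment> \<open>The square of this Gram matrix is the nonsingular \<open>M\<close>, so it is
    nonsingular itself and \<open>spd_mat_gram\<close> applies.\<close>
  have "det (R * R\<^sup>T) \<noteq> 0"
    using det_mult[OF RRc RRc] sq spd_mat_det_nonzero[OF M spd] by auto
  from that[OF RRc spd_mat_gram[OF R this] sq] show thesis .
qed

lemma mat_sqrt:
  assumes M: "M \<in> carrier_mat n n" and spd: "spd_mat M"
  shows "mat_sqrt M \<in> carrier_mat n n" "spd_mat (mat_sqrt M)" "mat_sqrt M * mat_sqrt M = M"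
proof -
  obtain S where S: "S \<in> carrier_mat n n" "spd_mat S" "S * S = M"
    using spd_sqrt_exists[OF assms] by blast
  have "mat_sqrt M = S"
    unfolding mat_sqrt_def
  proof (rule the_equality)
    show "T = S" if "T \<in> carrier_mat (dim_row M) (dim_row M) \<and> spd_mat T \<and> T * T = M" for T
      using spd_sqrt_unique[of T n S] that S M by auto
  qed (use S M in auto)
  with S show "mat_sqrt M \<in> carrier_mat n n" "spd_mat (mat_sqrt M)" "mat_sqrt M * mat_sqrt M = M"
    by auto
qed

lemma mat_inv_sqrt:
  assumes M: "M \<in> carrier_mat n n" and spd: "spd_mat M"
  shows "mat_inv_sqrt M \<in> carrier_mat n n" "(mat_inv_sqrt M)\<^sup>T = mat_inv_sqrt M"
    "mat_inv_sqrt M * M * mat_inv_sqrt M = 1\<^sub>m n" "mat_inv_sqrt M * mat_inv_sqrt M = mat_inv M"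
    "det (mat_inv_sqrt M) \<noteq> 0"
proof -
  define S where "S = mat_sqrt M"
  define K where "K = mat_inv S"
  have K_eq: "mat_inv_sqrt M = K" by (simp add: K_def S_def mat_inv_sqrt_def)
  note S = mat_sqrt[OF assms, folded S_def]
  note detS = spd_mat_det_nonzero[OF S(1,2)]
  note K = mat_inv_carrier[OF S(1) detS, folded K_def]
  note SK = mat_inv_right[OF S(1) detS, folded K_def]
  note KS = mat_inv_left[OF S(1) detS, folded K_def]
  note [simp] = carrier_matD[OF S(1)] carrier_matD[OF K]
  have ST: "S\<^sup>T = S" using S(2) by (simp add: spd_mat_def)
  \<comment> \<open>Since \<open>S\<close> is symmetric, the transpose of its inverse is again an
    inverse; uniqueness gives the symmetry of \<open>K\<close>.\<close>
  have "S * K\<^sup>T = (K * S)\<^sup>T" by (simp add: transpose_mult_dims ST)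
  then have "S * K\<^sup>T = 1\<^sub>m n" by (simp add: KS)
  from mat_invI[OF S(1) _ this] K have KT: "K\<^sup>T = K" by (simp add: K_def)
  have "K * M * K = (K * S) * (S * K)" by (simp add: S(3)[symmetric] mat_assoc)
  then have KMK: "K * M * K = 1\<^sub>m n" by (simp add: KS SK)
  have "M * (K * K) = S * (S * K) * K" by (simp add: S(3)[symmetric] mat_assoc)
  then have "M * (K * K) = 1\<^sub>m n" using S by (simp add: SK)
  then have "mat_inv M = K * K" by (intro mat_invI[OF M]) (use K in auto)
  moreover have "det K \<noteq> 0" using det_mult[OF K S(1)] by (auto simp: KS)
  ultimately show "mat_inv_sqrt M \<in> carrier_mat n n" "(mat_inv_sqrt M)\<^sup>T = mat_inv_sqrt M"
    "mat_inv_sqrt M * M * mat_inv_sqrt M = 1\<^sub>m n" "mat_inv_sqrt M * mat_inv_sqrt M = mat_inv M"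
    "det (mat_inv_sqrt M) \<noteq> 0"
    unfolding K_eq using K KT KMK by auto
qed


subsection \<open>Entrywise limits\<close>

lemma mat_tendstoD:
  "mat_tendsto X A \<Longrightarrow> A \<in> carrier_mat m n \<Longrightarrow> i < m \<Longrightarrow> j < n \<Longrightarrow>
    (\<lambda>t. X t $$ (i,j)) \<longlonglongrightarrow> A $$ (i,j)"
  by (auto simp: mat_tendsto_def)

lemma mat_tendsto_const: "mat_tendsto (\<lambda>_. A) A"
  by (simp add: mat_tendsto_def)

lemma mat_tendsto_mult:
  assumes X: "\<And>t. X t \<in> carrier_mat m n" "A \<in> carrier_mat m n" "mat_tendsto X A"
    and Y: "\<And>t. Y t \<in> carrier_mat n k" "B \<in> carrier_mat n k" "mat_tendsto Y B"
  shows "mat_tendsto (\<lambda>t. X t * Y t) (A * B)"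
  unfolding mat_tendsto_def
proof (intro allI impI)
  fix i j assume "i < dim_row (A * B)" "j < dim_col (A * B)"
  then have ij: "i < m" "j < k" using X(2) Y(2) by auto
  have prod: "(C * D) $$ (i,j) = (\<Sum>l = 0..<n. C $$ (i,l) * D $$ (l,j))"
    if "C \<in> carrier_mat m n" "D \<in> carrier_mat n k" for C D :: "real mat"
    using that ij by (simp add: scalar_prod_def)
  show "(\<lambda>t. (X t * Y t) $$ (i,j)) \<longlonglongrightarrow> (A * B) $$ (i,j)"
    unfolding prod[OF X(1) Y(1)] prod[OF X(2) Y(2)]
    using ij by (intro tendsto_sum tendsto_mult mat_tendstoD[OF X(3,2)] mat_tendstoD[OF Y(3,2)]) auto
qed

lemma mat_tendsto_transpose:
  assumes "\<And>t. X t \<in> carrier_mat m n" "A \<in> carrier_mat m n" "mat_tendsto X A"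
  shows "mat_tendsto (\<lambda>t. (X t)\<^sup>T) (A\<^sup>T)"
  unfolding mat_tendsto_def
proof (intro allI impI)
  fix i j assume "i < dim_row A\<^sup>T" "j < dim_col A\<^sup>T"
  then have "i < n" "j < m" using assms(2) by auto
  moreover have "dim_row (X t) = m" "dim_col (X t) = n" for t using assms(1)[of t] by auto
  ultimately show "(\<lambda>t. (X t)\<^sup>T $$ (i,j)) \<longlonglongrightarrow> A\<^sup>T $$ (i,j)"
    using assms(2) mat_tendstoD[OF assms(3,2)] by simp
qed

text \<open>By the Leibniz formula the determinant is a polynomial in the entries.\<close>

lemma tendsto_det:
  assumes X: "\<And>t. X t \<in> carrier_mat n n" and A: "A \<in> carrier_mat n n" and lim: "mat_tendsto X A"
  shows "(\<lambda>t. det (X t)) \<longlonglongrightarrow> (det A :: real)"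
  unfolding det_def'[OF X] det_def'[OF A]
proof (intro tendsto_sum tendsto_mult tendsto_const tendsto_prod mat_tendstoD[OF lim A])
  fix p i assume "p \<in> {p. p permutes {0..<n}}" "i \<in> {0..<n}"
  then show "i < n" "p i < n" using permutes_in_image[of p "{0..<n}" i] by auto
qed

lemma mat_tendsto_mat_inv:
  assumes X: "\<And>t. X t \<in> carrier_mat n n" "\<And>t. det (X t) \<noteq> 0"
    and A: "A \<in> carrier_mat n n" "det A \<noteq> 0" and lim: "mat_tendsto X A"
  shows "mat_tendsto (\<lambda>t. mat_inv (X t)) (mat_inv A)"
  unfolding mat_tendsto_def
proof (intro allI impI)
  fix i j assume "i < dim_row (mat_inv A)" "j < dim_col (mat_inv A)"
  then have ij: "i < n" "j < n" using mat_inv_carrier[OF A] by auto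
  \<comment> \<open>The adjugate is the transposed cofactor matrix, hence row \<open>j\<close> and
    column \<open>i\<close> are deleted for the entry \<open>(i,j)\<close>.\<close>
  have inv: "mat_inv B $$ (i,j) = 1 / det B * ((-1) ^ (j + i) * det (mat_delete B j i))"
    if "B \<in> carrier_mat n n" "det B \<noteq> 0" for B
    using that ij by (simp add: mat_inv_adj adj_mat_def cofactor_def)
  have del: "mat_delete B j i \<in> carrier_mat (n - 1) (n - 1)" if "B \<in> carrier_mat n n" for B :: "real mat"
    using mat_delete_carrier[OF that] .
  have "mat_tendsto (\<lambda>t. mat_delete (X t) j i) (mat_delete A j i)"
    unfolding mat_tendsto_def
  proof (intro allI impI)
    fix k l assume "k < dim_row (mat_delete A j i)" "l < dim_col (mat_delete A j i)"
    then have kl: "k < n - 1" "l < n - 1" using A by auto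
    \<comment> \<open>Each entry of the minor is an entry of \<open>B\<close> at a position that is
      the same for all \<open>B\<close>, so its limit is inherited.\<close>
    have entry: "mat_delete B j i $$ (k,l) = B $$ (if k < j then k else Suc k, if l < i then l else Suc l)"
      if "B \<in> carrier_mat n n" for B :: "real mat"
      using that kl by (auto simp: mat_delete_def)
    show "(\<lambda>t. mat_delete (X t) j i $$ (k,l)) \<longlonglongrightarrow> mat_delete A j i $$ (k,l)"
      unfolding entry[OF X(1)] entry[OF A(1)] using kl by (intro mat_tendstoD[OF lim A(1)]) auto
  qed
  then show "(\<lambda>t. mat_inv (X t) $$ (i,j)) \<longlonglongrightarrow> mat_inv A $$ (i,j)"
    unfolding inv[OF X] inv[OF A]
    using A by (intro tendsto_intros tendsto_det[OF X(1) A(1) lim] tendsto_det[OF del[OF X(1)] del[OF A(1)]])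
qed

text \<open>At full row rank \<open>row_proj\<close> is the orthogonal projector onto the row space,
  so this limit expresses convergence of row spaces. All factors converge because inversion is
  continuous at the nonsingular limit Gram matrix.\<close>

lemma row_proj_tendsto:
  assumes X: "\<And>t. X t \<in> carrier_mat m n" "\<And>t. det (X t * (X t)\<^sup>T) \<noteq> 0"
    and A: "A \<in> carrier_mat m n" "det (A * A\<^sup>T) \<noteq> 0" and lim: "mat_tendsto X A"
  shows "mat_tendsto (\<lambda>t. row_proj (X t)) (row_proj A)"
proof -
  have T: "(X t)\<^sup>T \<in> carrier_mat n m" "A\<^sup>T \<in> carrier_mat n m" for t using X(1) A(1) by auto
  have gram: "X t * (X t)\<^sup>T \<in> carrier_mat m m" "A * A\<^sup>T \<in> carrier_mat m m" for t
    using X(1) A(1) by (auto intro: mult_carrier_mat T)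
  note limT = mat_tendsto_transpose[OF X(1) A(1) lim]
  note inv = mat_inv_carrier[OF gram(1) X(2)] mat_inv_carrier[OF gram(2) A(2)]
  note lim_inv = mat_tendsto_mat_inv[OF gram(1) X(2) gram(2) A(2)
      mat_tendsto_mult[OF X(1) A(1) lim T limT]]
  show ?thesis
    unfolding row_proj_def
    by (rule mat_tendsto_mult[OF mult_carrier_mat[OF T(1) inv(1)] mult_carrier_mat[OF T(2) inv(2)]
          mat_tendsto_mult[OF T limT inv lim_inv] X(1) A(1) lim])
qed

subsection \<open>Row spaces, whitening and leading columns\<close>

text \<open>The inverse Gram matrix of \<open>C * M\<close> is \<open>D\<^sup>T * H * D\<close> with
  \<open>D\<close> inverse to \<open>C\<close>, and the outer factors cancel against those of
  \<open>C * M\<close>.\<close>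

lemma row_proj_mult_left:
  assumes C: "C \<in> carrier_mat m m" "det C \<noteq> 0" and M: "M \<in> carrier_mat m n" "det (M * M\<^sup>T) \<noteq> 0"
  shows "row_proj (C * M) = row_proj M"
proof -
  define D where "D = mat_inv C"
  define H where "H = mat_inv (M * M\<^sup>T)"
  have MM: "M * M\<^sup>T \<in> carrier_mat m m" using M by simp
  have D: "D \<in> carrier_mat m m" and H: "H \<in> carrier_mat m m"
    using mat_inv_carrier[OF C] mat_inv_carrier[OF MM M(2)] by (simp_all add: D_def H_def)
  note [simp] = carrier_matD[OF C(1)] carrier_matD[OF M(1)] carrier_matD[OF D] carrier_matD[OF H]
  have CD: "C * D = 1\<^sub>m m" and DC: "D * C = 1\<^sub>m m"
    using mat_inv_right[OF C] mat_inv_left[OF C] by (simp_all add: D_def)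
  have CD': "C\<^sup>T * D\<^sup>T = 1\<^sub>m m"
    using transpose_mult_dims[of D C] by (simp add: DC)
  have MH: "M * M\<^sup>T * H = 1\<^sub>m m" using mat_inv_right[OF MM M(2)] by (simp add: H_def)
  have "C * M * (C * M)\<^sup>T * (D\<^sup>T * H * D) = C * (M * M\<^sup>T * (C\<^sup>T * D\<^sup>T) * H) * D"
    by (simp add: transpose_mult_dims mat_assoc)
  also have "\<dots> = 1\<^sub>m m" using C MM by (simp add: CD' MH CD)
  finally have "mat_inv (C * M * (C * M)\<^sup>T) = D\<^sup>T * H * D"
    by (intro mat_invI[of _ m]) (auto intro!: carrier_matI)
  then have "row_proj (C * M) = M\<^sup>T * (C\<^sup>T * D\<^sup>T) * H * (D * C) * M"
    by (simp add: row_proj_def transpose_mult_dims mat_assoc)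
  also have "\<dots> = row_proj M"
    using M H by (simp add: CD' DC row_proj_def H_def[symmetric] mat_assoc)
  finally show ?thesis .
qed

lemma whiten_left_multiple:
  assumes M: "M \<in> carrier_mat m n" "det (M * M\<^sup>T) \<noteq> 0"
  obtains C where "C \<in> carrier_mat m m" "det C \<noteq> 0" "whiten M = C * M"
  using that mat_inv_sqrt(1,5)[OF _ spd_mat_gram[OF M], of m] M by (auto simp: whiten_def)

text \<open>The last equation rewrites the least squares projection as \<open>X\<^sup>T * X\<close>
  with \<open>X = K * F\<close>, which turns each half step of the iteration into plain products of
  whitened data.\<close>

lemma gram_whitening:
  assumes F: "F \<in> carrier_mat d n" and det: "det (F * F\<^sup>T) \<noteq> 0"
  defines "K \<equiv> mat_inv_sqrt (F * F\<^sup>T)"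
  shows "K \<in> carrier_mat d d" "K\<^sup>T = K" "K * F * (K * F)\<^sup>T = 1\<^sub>m d"
    "F\<^sup>T * mat_inv (F * F\<^sup>T) * F = (K * F)\<^sup>T * (K * F)"
proof -
  have FF: "F * F\<^sup>T \<in> carrier_mat d d" using F by simp
  note K = mat_inv_sqrt[OF FF spd_mat_gram[OF F det], folded K_def]
  show "K \<in> carrier_mat d d" "K\<^sup>T = K" by (fact K)+
  note dims = carrier_matD[OF K(1)] carrier_matD[OF F]
  show "K * F * (K * F)\<^sup>T = 1\<^sub>m d"
    using K(3) by (simp add: transpose_mult_dims K(2) mat_assoc dims)
  show "F\<^sup>T * mat_inv (F * F\<^sup>T) * F = (K * F)\<^sup>T * (K * F)"
    by (simp add: transpose_mult_dims K(2) K(4)[symmetric] mat_assoc dims)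
qed

section \<open>Leading columns and rectangular diagonal matrices\<close>

lemma first_cols_carrier: "M \<in> carrier_mat m n \<Longrightarrow> first_cols M k \<in> carrier_mat m k"
  by (simp add: first_cols_def)

text \<open>Truncation written as a product with a selector matrix can take part in associativity
  rewriting.\<close>

lemma first_cols_mult:
  assumes "M \<in> carrier_mat m n" "k \<le> n"
  shows "M * first_cols (1\<^sub>m n) k = first_cols M k"
proof (rule eq_matI)
  fix i j assume "i < dim_row (first_cols M k)" "j < dim_col (first_cols M k)"
  then have "i < m" "j < k" using assms by (auto simp: first_cols_def)
  then show "(M * first_cols (1\<^sub>m n) k) $$ (i,j) = first_cols M k $$ (i,j)"
    using assms by (simp add: first_cols_def scalar_prod_def if_distrib[of "\<lambda>x. _ * x"] sum.delta' cong: if_cong)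
qed (use assms in \<open>auto simp: first_cols_def\<close>)


lemma first_cols_orthonormal:
  assumes "M \<in> carrier_mat m n" "orthonormal_cols M" "k \<le> n"
  shows "(first_cols M k)\<^sup>T * first_cols M k = 1\<^sub>m k"
proof (rule eq_matI)
  fix i j assume "i < dim_row (1\<^sub>m k :: real mat)" "j < dim_col (1\<^sub>m k :: real mat)"
  then have ij: "i < k" "j < k" by auto
  have "((first_cols M k)\<^sup>T * first_cols M k) $$ (i,j) = (M\<^sup>T * M) $$ (i,j)"
    using ij assms by (simp add: first_cols_def scalar_prod_def)
  then show "((first_cols M k)\<^sup>T * first_cols M k) $$ (i,j) = 1\<^sub>m k $$ (i,j)"
    using ij assms by (simp add: orthonormal_cols_def del: index_mult_mat)
qed (simp_all add: first_cols_def)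

text \<open>If \<open>m > n\<close>, the rows from index \<open>n\<close> on are zero, whence the
  case distinction.\<close>

lemma rect_diag_mult_transpose:
  "rect_diag m n f * (rect_diag m n f)\<^sup>T = mat_diag m (\<lambda>i. if i < n then f i * f i else 0)"
proof (rule eq_matI)
  fix i j assume "i < dim_row (mat_diag m (\<lambda>i. if i < n then f i * f i else 0))"
    "j < dim_col (mat_diag m (\<lambda>i. if i < n then f i * f i else 0))"
  then have ij: "i < m" "j < m" by (auto simp: mat_diag_def)
  have "(\<Sum>k = 0..<n. (if i = k then f i else 0) * (if j = k then f j else 0))
      = (\<Sum>k = 0..<n. if i = k then (if i = j then f i * f i else 0) else 0)"
    by (intro sum.cong) auto
  then show "(rect_diag m n f * (rect_diag m n f)\<^sup>T) $$ (i,j)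
      = mat_diag m (\<lambda>i. if i < n then f i * f i else 0) $$ (i,j)"
    using ij by (simp add: rect_diag_def mat_diag_def scalar_prod_def)
qed (auto simp: rect_diag_def mat_diag_def)

lemma rect_diag_mult_entry:
  assumes "A \<in> carrier_mat r m" "i < r" "j < n" "j < m"
  shows "(A * rect_diag m n f) $$ (i,j) = A $$ (i,j) * f j"
  using assms
  by (simp add: rect_diag_def scalar_prod_def if_distrib[of "\<lambda>x. _ * x"] sum.delta' cong: if_cong)

subsection \<open>Orthogonal iteration\<close>

text \<open>Here \<open>W t\<close> is \<open>U0\<^sup>T\<close> times the \<open>t\<close>-th power
  of \<open>S * S\<^sup>T\<close>, multiplied on the left by the inverse of
  \<open>U0\<^sup>T * first_cols P L\<close> and then by \<Lambda> to the power \<open>-2 t\<close>.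
  The identities with right factors \<open>first_cols P L\<close> and \<open>first_cols Q L\<close>
  later certify full row rank, and the recurrence carries one round of the iteration from
  \<open>W t\<close> to \<open>W (Suc t)\<close>.\<close>

lemma subspace_iterates:
  fixes P Q U0 :: "real mat" and \<sigma> :: "nat \<Rightarrow> real"
  assumes P: "P \<in> carrier_mat dx dx" "orthonormal_cols P"
    and Q: "Q \<in> carrier_mat dy dy" "orthonormal_cols Q"
    and L: "1 \<le> L" "L \<le> min dx dy"
    and sv_mono: "\<And>i j. i \<le> j \<Longrightarrow> j < min dx dy \<Longrightarrow> \<sigma> j \<le> \<sigma> i"
    and sv_nonneg: "\<And>i. i < min dx dy \<Longrightarrow> 0 \<le> \<sigma> i"
    and gap: "\<sigma> (L - 1) > (if L < min dx dy then \<sigma> L else 0)"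
    and U0: "U0 \<in> carrier_mat dx L"
    and nonsing: "det (U0\<^sup>T * first_cols P L) \<noteq> 0"
  defines "S \<equiv> P * rect_diag dx dy \<sigma> * Q\<^sup>T"
  obtains W \<Lambda> where "\<And>t::nat. W t \<in> carrier_mat L dx" "\<And>t. W t * first_cols P L = 1\<^sub>m L"
    "\<And>t. W t * S * first_cols Q L = \<Lambda>" "\<And>t. W t * S * S\<^sup>T = \<Lambda> * \<Lambda> * W (Suc t)"
    "U0\<^sup>T = U0\<^sup>T * first_cols P L * W 0" "mat_tendsto W ((first_cols P L)\<^sup>T)"
    "\<Lambda> \<in> carrier_mat L L" "det \<Lambda> \<noteq> 0" "(first_cols P L)\<^sup>T * S = \<Lambda> * (first_cols Q L)\<^sup>T"
proof -
  have PP: "P\<^sup>T * P = 1\<^sub>m dx" and QQ: "Q\<^sup>T * Q = 1\<^sub>m dy"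
    using P Q by (auto simp: orthonormal_cols_def)
  have PP': "P * P\<^sup>T = 1\<^sub>m dx"
    by (rule mat_mult_left_right_inverse[OF _ P(1) PP]) (use P in auto)
  define D where "D = rect_diag dx dy \<sigma>"
  have D: "D \<in> carrier_mat dx dy" by (simp add: D_def rect_diag_def)
  define J where "J = (first_cols (1\<^sub>m dx) L :: real mat)"
  define J' where "J' = (first_cols (1\<^sub>m dy) L :: real mat)"
  have J: "J \<in> carrier_mat dx L" and J': "J' \<in> carrier_mat dy L"
    by (auto simp: J_def J'_def intro!: first_cols_carrier)
  have PL: "first_cols P L = P * J" and QL: "first_cols Q L = Q * J'"
    unfolding J_def J'_def using first_cols_mult[OF P(1)] first_cols_mult[OF Q(1)] L by auto
  define \<Lambda> where "\<Lambda> = mat_diag L \<sigma>"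
  have \<Lambda>: "\<Lambda> \<in> carrier_mat L L" by (simp add: \<Lambda>_def)
  define E where "E = U0\<^sup>T * first_cols P L"
  have E: "E \<in> carrier_mat L L" "det E \<noteq> 0"
    using U0 P nonsing by (auto simp: E_def PL J intro!: mult_carrier_mat[of _ L dx] mult_carrier_mat[of _ dx dx])
  define Ei where "Ei = mat_inv E"
  have Ei: "Ei \<in> carrier_mat L L" "Ei * E = 1\<^sub>m L" "E * Ei = 1\<^sub>m L"
    using mat_inv_carrier[OF E] mat_inv_left[OF E] mat_inv_right[OF E] by (simp_all add: Ei_def)
  note dims = carrier_matD[OF P(1)] carrier_matD[OF Q(1)] carrier_matD[OF D] carrier_matD[OF J]
    carrier_matD[OF J'] carrier_matD[OF \<Lambda>] carrier_matD[OF Ei(1)] carrier_matD[OF E(1)] carrier_matD[OF U0]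
  \<comment> \<open>Extension of \<sigma> by zero to all \<open>dx\<close> coordinates: if
    \<open>dx > dy\<close>, the matrix \<open>D * D\<^sup>T\<close> has further zero eigenvalues,
    while \<sigma> is arbitrary at those indices.\<close>
  define s where "s j = (if j < min dx dy then \<sigma> j else 0)" for j
  \<comment> \<open>For \<open>L = min dx dy\<close> the gap itself says that the last singular
    value is positive; otherwise positivity follows from \<open>\<sigma> L\<close> being
    nonnegative.\<close>
  have \<sigma>_last: "\<sigma> (L - 1) > 0" "L < min dx dy \<Longrightarrow> \<sigma> L < \<sigma> (L - 1)"
    using gap sv_nonneg[of L] by (auto split: if_splits)
  have \<sigma>_ge: "\<sigma> (L - 1) \<le> \<sigma> i" if "i < L" for i
    by (rule sv_mono) (use that L in auto)
  have \<sigma>_pos: "\<sigma> i > 0" if "i < L" for i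
    using \<sigma>_ge[OF that] \<sigma>_last(1) by simp
  have s_less: "0 \<le> s j \<and> s j < \<sigma> i" if "i < L" "L \<le> j" for i j
    using \<sigma>_ge[OF that(1)] \<sigma>_pos[OF that(1)] \<sigma>_last(2) sv_mono[of L j] sv_nonneg[of j] that
    by (fastforce simp: s_def)
  \<comment> \<open>Coordinates of the normalised start: the factor \<open>Ei\<close> turns the
    leading \<open>L\<close> columns into the identity.\<close>
  define H where "H = Ei * U0\<^sup>T * P"
  have H: "H \<in> carrier_mat L dx" by (auto simp: H_def dims)
  have "H * J = Ei * E" by (simp add: H_def E_def PL mat_assoc dims)
  then have HJ: "first_cols H L = 1\<^sub>m L" using first_cols_mult[OF H, of L] L by (simp add: J_def Ei)
  have H_id: "H $$ (i,j) = (if i = j then 1 else 0)" if "i < L" "j < L" for i j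
    using arg_cong[OF HJ, of "\<lambda>M. M $$ (i,j)"] that H by (simp add: first_cols_def)
  \<comment> \<open>The coordinates with respect to \<open>P\<close> of the normalised iterates \<open>W t\<close>.\<close>
  define V where "V t = mat L dx (\<lambda>(i,j). H $$ (i,j) * (s j / \<sigma> i) ^ (2 * t))" for t :: nat
  have V: "V t \<in> carrier_mat L dx" for t by (simp add: V_def)
  note dims = dims carrier_matD[OF V]
  \<comment> \<open>The leading block never changes: its off-diagonal entries are zero in
    \<open>H\<close>, and on the diagonal the ratio is one.\<close>
  have V_id: "V t $$ (i,j) = (if i = j then 1 else 0)" if "i < L" "j < L" for t i j
    using that L \<sigma>_pos[of i] by (auto simp: V_def H_id s_def)
  define W where "W t = V t * P\<^sup>T" for t
  have WP: "W t * P = V t" for t using V by (simp add: W_def mat_assoc PP dims)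
  have W_carrier: "W t \<in> carrier_mat L dx" for t by (auto simp: W_def dims)
  note dims = dims carrier_matD[OF W_carrier]
  have 1: "W t * first_cols P L = 1\<^sub>m L" for t
  proof -
    have "W t * first_cols P L = W t * P * J" by (simp add: PL mat_assoc dims)
    also have "\<dots> = first_cols (V t) L" unfolding WP J_def using L by (intro first_cols_mult[OF V]) simp
    also have "\<dots> = 1\<^sub>m L" by (rule eq_matI) (use L in \<open>auto simp: first_cols_def V_id dims\<close>)
    finally show ?thesis .
  qed
  have 2: "W t * S * first_cols Q L = \<Lambda>" for t
  proof -
    have "W t * S * first_cols Q L = W t * P * D * (Q\<^sup>T * Q) * J'"
      by (simp add: S_def D_def[symmetric] QL mat_assoc dims)
    also have "\<dots> = V t * D * J'" using V D by (simp add: WP QQ)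
    also have "\<dots> = first_cols (V t * D) L"
      unfolding J'_def using L by (intro first_cols_mult[OF mult_carrier_mat[OF V D]]) simp
    also have "\<dots> = \<Lambda>"
    proof (rule eq_matI)
      fix i j assume "i < dim_row \<Lambda>" "j < dim_col \<Lambda>"
      then have ij: "i < L" "j < L" by (simp_all add: dims)
      then show "first_cols (V t * D) L $$ (i,j) = \<Lambda> $$ (i,j)"
        using L rect_diag_mult_entry[OF V[of t], of i j dy \<sigma>]
        by (simp add: first_cols_def D_def[symmetric] V_id dims \<Lambda>_def mat_diag_def)
    qed (simp_all add: first_cols_def dims)
    finally show ?thesis .
  qed
  have 3: "W t * S * S\<^sup>T = \<Lambda> * \<Lambda> * W (Suc t)" for t
  proof -
    have "W t * S * S\<^sup>T = W t * P * D * (Q\<^sup>T * Q) * D\<^sup>T * P\<^sup>T"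
      by (simp add: S_def D_def[symmetric] transpose_mult_dims mat_assoc dims)
    also have "\<dots> = V t * (D * D\<^sup>T) * P\<^sup>T" using V D by (simp add: WP QQ mat_assoc dims)
    also have "V t * (D * D\<^sup>T) = \<Lambda> * \<Lambda> * V (Suc t)"
    proof (rule eq_matI)
      fix i j assume "i < dim_row (\<Lambda> * \<Lambda> * V (Suc t))" "j < dim_col (\<Lambda> * \<Lambda> * V (Suc t))"
      then have ij: "i < L" "j < dx" by (simp_all add: dims)
      have DD: "D * D\<^sup>T = mat_diag dx (\<lambda>j. s j * s j)"
        unfolding D_def rect_diag_mult_transpose mat_diag_def
        by (rule eq_matI) (auto simp: s_def)
      have "(V t * (D * D\<^sup>T)) $$ (i,j) = H $$ (i,j) * (s j / \<sigma> i) ^ (2 * t) * (s j * s j)"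
        using ij by (simp add: DD mat_diag_mult_right[OF V]) (simp add: V_def)
      \<comment> \<open>Writing \<open>s j\<close> as \<open>\<sigma> i\<close> times the ratio
        \<open>s j / \<sigma> i\<close> raises the exponent by two and leaves the square of
        \<open>\<sigma> i\<close> for the factor \<open>\<Lambda> * \<Lambda>\<close>.\<close>
      also have "\<dots> = \<sigma> i * \<sigma> i * (H $$ (i,j) * (s j / \<sigma> i) ^ (2 * Suc t))"
        using \<sigma>_pos[OF ij(1)] by (simp add: field_simps)
      also have "\<dots> = (\<Lambda> * \<Lambda> * V (Suc t)) $$ (i,j)"
        using ij by (simp add: \<Lambda>_def mat_diag_mult_left[OF V]) (simp add: V_def)
      finally show "(V t * (D * D\<^sup>T)) $$ (i,j) = (\<Lambda> * \<Lambda> * V (Suc t)) $$ (i,j)" .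
    qed (simp_all add: dims)
    finally show ?thesis by (simp add: W_def mat_assoc dims)
  qed
  have 4: "U0\<^sup>T = U0\<^sup>T * first_cols P L * W 0"
  proof -
    have "V 0 = H" by (rule eq_matI) (use H in \<open>auto simp: V_def\<close>)
    then have "E * W 0 = (E * Ei) * U0\<^sup>T * (P * P\<^sup>T)"
      by (simp add: W_def H_def mat_assoc dims)
    then have "E * W 0 = U0\<^sup>T" using U0 by (simp add: Ei(3) PP')
    then show ?thesis by (simp add: E_def)
  qed
  have V_lim: "mat_tendsto V (J\<^sup>T)"
    unfolding mat_tendsto_def
  proof (intro allI impI)
    fix i j assume "i < dim_row J\<^sup>T" "j < dim_col J\<^sup>T"
    then have ij: "i < L" "j < dx" by (simp_all add: dims)
    then have JT: "J\<^sup>T $$ (i,j) = (if i = j then 1 else 0)" using L by (auto simp: J_def first_cols_def)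
    show "(\<lambda>t. V t $$ (i,j)) \<longlonglongrightarrow> J\<^sup>T $$ (i,j)"
    proof (cases "j < L")
      case True
      then show ?thesis using ij by (simp add: V_id JT)
    next
      case False
      \<comment> \<open>The strict singular value gap enters the limit here: outside the leading
        block the decay is geometric.\<close>
      have "\<bar>(s j / \<sigma> i)\<^sup>2\<bar> < 1"
        using s_less[OF ij(1), of j] \<sigma>_pos[OF ij(1)] False by (simp add: abs_square_less_1)
      then have "(\<lambda>t. H $$ (i,j) * ((s j / \<sigma> i)\<^sup>2) ^ t) \<longlonglongrightarrow> H $$ (i,j) * 0"
        by (intro tendsto_intros LIMSEQ_abs_realpow_zero2)
      then show ?thesis using ij False by (simp add: V_def JT power_mult)
    qed
  qed
  have "mat_tendsto W (J\<^sup>T * P\<^sup>T)"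
    unfolding W_def by (rule mat_tendsto_mult[OF V _ V_lim _ _ mat_tendsto_const]) (use J P in auto)
  then have 5: "mat_tendsto W ((first_cols P L)\<^sup>T)"
    by (simp add: PL transpose_mult_dims dims)
  have "det \<Lambda> = prod_list (diag_mat \<Lambda>)"
    by (rule det_upper_triangular[OF _ \<Lambda>]) (auto simp: \<Lambda>_def mat_diag_def upper_triangular_def)
  moreover have "0 \<notin> set (diag_mat \<Lambda>)"
    using \<sigma>_pos by (fastforce simp: \<Lambda>_def mat_diag_def diag_mat_def)
  ultimately have 6: "det \<Lambda> \<noteq> 0" by (simp add: prod_list_zero_iff)
  have "J\<^sup>T * D = \<Lambda> * J'\<^sup>T"
  proof (rule eq_matI)
    fix i j assume "i < dim_row (\<Lambda> * J'\<^sup>T)" "j < dim_col (\<Lambda> * J'\<^sup>T)"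
    then have ij: "i < L" "j < dy" by (simp_all add: dims)
    have "(\<Lambda> * J'\<^sup>T) $$ (i,j) = \<sigma> i * J' $$ (j,i)"
      unfolding \<Lambda>_def using ij J' by (subst mat_diag_mult_left[of _ L dy]) auto
    moreover have "(J\<^sup>T * D) $$ (i,j) = D $$ (i,j)"
      using ij L by (simp add: J_def first_cols_def scalar_prod_def dims
          if_distrib[of "\<lambda>x. x * _"] sum.delta cong: if_cong)
    ultimately show "(J\<^sup>T * D) $$ (i,j) = (\<Lambda> * J'\<^sup>T) $$ (i,j)"
      using ij L by (auto simp: J'_def first_cols_def D_def rect_diag_def)
  qed (simp_all add: dims)
  moreover have "(first_cols P L)\<^sup>T * S = J\<^sup>T * (P\<^sup>T * P) * D * Q\<^sup>T"
    by (simp add: PL S_def D_def[symmetric] transpose_mult_dims mat_assoc dims)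
  ultimately have 7: "(first_cols P L)\<^sup>T * S = \<Lambda> * (first_cols Q L)\<^sup>T"
    using J by (simp add: PP QL transpose_mult_dims mat_assoc dims)
  show thesis by (rule that[OF W_carrier 1 2 3 4 5 \<Lambda> 6 7])
qed

section \<open>Alternating least squares as orthogonal iteration\<close>

theorem theorem1:
  fixes F G U0 P Q :: "real mat" and \<sigma> :: "nat \<Rightarrow> real" and dx dy N L :: nat
  assumes F: "F \<in> carrier_mat dx N" and G: "G \<in> carrier_mat dy N"
    and inv_ff: "invertible_mat (F * transpose_mat F)"
    and inv_gg: "invertible_mat (G * transpose_mat G)"
    and L: "1 \<le> L" "L \<le> min dx dy"
    (* full SVD  Sigma~_fg = P D Q^T  with singular values sigma_1 >= ... >= sigma_min(dx,dy) >= 0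
       (0-indexed: sigma 0 >= sigma 1 >= ...) *)
    and P: "P \<in> carrier_mat dx dx" "orthonormal_cols P"
    and Q: "Q \<in> carrier_mat dy dy" "orthonormal_cols Q"
    and svd: "mat_inv_sqrt (F * transpose_mat F) * (F * transpose_mat G)
                * mat_inv_sqrt (G * transpose_mat G)
              = P * rect_diag dx dy \<sigma> * transpose_mat Q"
    and sv_mono: "\<And>i j. i \<le> j \<Longrightarrow> j < min dx dy \<Longrightarrow> \<sigma> j \<le> \<sigma> i"
    and sv_nonneg: "\<And>i. i < min dx dy \<Longrightarrow> 0 \<le> \<sigma> i"
    and gap: "\<sigma> (L - 1) > (if L < min dx dy then \<sigma> L else 0)"
    and U0: "U0 \<in> carrier_mat dx L" "transpose_mat U0 * U0 = 1\<^sub>m L"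
    and U0_nonsing: "invertible_mat (transpose_mat U0 * first_cols P L)"
  shows "mat_tendsto (\<lambda>T. row_proj (fst (als F G U0 T)))
           (row_proj (transpose_mat (mat_inv_sqrt (F * transpose_mat F) * first_cols P L) * F))
       \<and> mat_tendsto (\<lambda>T. row_proj (snd (als F G U0 T)))
           (row_proj (transpose_mat (mat_inv_sqrt (G * transpose_mat G) * first_cols Q L) * G))"
proof -
  have detF: "det (F * F\<^sup>T) \<noteq> 0" and detG: "det (G * G\<^sup>T) \<noteq> 0"
    using invertible_mat_det_nonzero[of "F * F\<^sup>T" dx] invertible_mat_det_nonzero[of "G * G\<^sup>T" dy]
      F G inv_ff inv_gg by auto
  define K where "K = mat_inv_sqrt (F * F\<^sup>T)"
  define K' where "K' = mat_inv_sqrt (G * G\<^sup>T)"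
  define X where "X = K * F"
  define Y where "Y = K' * G"
  note K = gram_whitening[OF F detF, folded K_def X_def]
  note K' = gram_whitening[OF G detG, folded K'_def Y_def]
  define S where "S = P * rect_diag dx dy \<sigma> * Q\<^sup>T"
  define U where "U = first_cols P L"
  define V where "V = first_cols Q L"
  have U: "U \<in> carrier_mat dx L" and V: "V \<in> carrier_mat dy L"
    using P Q by (auto simp: U_def V_def intro: first_cols_carrier)
  have X: "X \<in> carrier_mat dx N" and Y: "Y \<in> carrier_mat dy N"
    using K(1) K'(1) F G by (auto simp: X_def Y_def)
  have S: "S \<in> carrier_mat dx dy" using P Q by (auto simp: S_def rect_diag_def)
  have "det (U0\<^sup>T * U) \<noteq> 0"
    using invertible_mat_det_nonzero[OF _ U0_nonsing, of L] U0 U by (auto simp: U_def)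
  then obtain W \<Lambda> where W: "\<And>t::nat. W t \<in> carrier_mat L dx" and WU: "\<And>t. W t * U = 1\<^sub>m L"
    and WSV: "\<And>t. W t * S * V = \<Lambda>" and WSS: "\<And>t. W t * S * S\<^sup>T = \<Lambda> * \<Lambda> * W (Suc t)"
    and W0: "U0\<^sup>T = U0\<^sup>T * U * W 0" and lim: "mat_tendsto W U\<^sup>T"
    and \<Lambda>: "\<Lambda> \<in> carrier_mat L L" "det \<Lambda> \<noteq> 0" and US: "U\<^sup>T * S = \<Lambda> * V\<^sup>T"
    using subspace_iterates[OF P Q L sv_mono sv_nonneg gap U0(1)] unfolding U_def V_def S_def by metis
  note dims = carrier_matD[OF F] carrier_matD[OF G] carrier_matD[OF K(1)] carrier_matD[OF K'(1)]
    carrier_matD[OF X] carrier_matD[OF Y] carrier_matD[OF S] carrier_matD[OF U] carrier_matD[OF V]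
    carrier_matD[OF W] carrier_matD[OF \<Lambda>(1)] carrier_matD[OF U0(1)]
  have XY: "X * Y\<^sup>T = S" 
    using svd by (simp add: X_def Y_def S_def K_def[symmetric] K'_def[symmetric]
        transpose_mult_dims K'(2) mat_assoc dims)
  then have YX: "Y * X\<^sup>T = S\<^sup>T" using transpose_mult_dims[of X "Y\<^sup>T"] by (simp add: dims)
  have WX: "W t * X \<in> carrier_mat L N" and WSY: "W t * S * Y \<in> carrier_mat L N" for t
    by (auto simp: dims)
  \<comment> \<open>\<open>X\<^sup>T * U\<close> is the right factor for
    \<open>det_gram_nonzero\<close>; \<open>Y\<^sup>T * V\<close> plays this role for the second
    view.\<close>
  have WX_right: "W t * X * (X\<^sup>T * U) = 1\<^sub>m L" for t
  proof -
    have "W t * X * (X\<^sup>T * U) = W t * (X * X\<^sup>T) * U" by (simp add: mat_assoc dims)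
    then show ?thesis by (simp add: K(3) WU right_mult_one_mat[OF W])
  qed
  have WSY_right: "W t * S * Y * (Y\<^sup>T * V) = \<Lambda>" for t
  proof -
    have "W t * S * Y * (Y\<^sup>T * V) = W t * S * (Y * Y\<^sup>T) * V" by (simp add: mat_assoc dims)
    then show ?thesis by (simp add: K'(3) WSV right_mult_one_mat[OF mult_carrier_mat[OF W S]])
  qed
  \<comment> \<open>The certificate \<open>J\<close> for \<open>R\<close> also serves
    \<open>C * R\<close>, so the whitening factor is nonsingular and can be absorbed into
    \<open>C'\<close>.\<close>
  have whiten_mult: "\<exists>C'. C' \<in> carrier_mat L L \<and> det C' \<noteq> 0 \<and> whiten (C * R) = C' * R"
    if C: "C \<in> carrier_mat L L" "det C \<noteq> 0" and R: "R \<in> carrier_mat L N"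
      and J: "J \<in> carrier_mat N L" "det (R * J) \<noteq> 0" for C R J
  proof -
    have CR: "C * R \<in> carrier_mat L N" using C R by simp
    have "C * R * J = C * (R * J)" using C R J by (simp add: mat_assoc)
    then have "det (C * R * J) \<noteq> 0" using det_mult[OF C(1), of "R * J"] C R J by simp
    then obtain C1 where C1: "C1 \<in> carrier_mat L L" "det C1 \<noteq> 0" "whiten (C * R) = C1 * (C * R)"
      using whiten_left_multiple[OF CR] det_gram_nonzero[OF CR J(1)] by blast
    then have "whiten (C * R) = C1 * C * R" using C R by (simp add: mat_assoc)
    then show ?thesis using C C1 det_mult[OF C1(1) C(1)] by (intro exI[of _ "C1 * C"]) simp
  qed
  have XU: "X\<^sup>T * U \<in> carrier_mat N L" and YV: "Y\<^sup>T * V \<in> carrier_mat N L" by (auto simp: dims)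
  \<comment> \<open>Projection onto the row space of \<open>G\<close> is
    \<open>Y\<^sup>T * Y\<close>, and \<open>X * Y\<^sup>T = S\<close> contributes one factor
    \<open>S\<close>.\<close>
  have B_step: "\<exists>C'. C' \<in> carrier_mat L L \<and> det C' \<noteq> 0 \<and>
      whiten (A * G\<^sup>T * mat_inv (G * G\<^sup>T) * G) = C' * (W t * S * Y)"
    if C: "C \<in> carrier_mat L L" "det C \<noteq> 0" and A: "A = C * (W t * X)" for A C t
  proof -
    have "mat_inv (G * G\<^sup>T) \<in> carrier_mat dy dy" using mat_inv_carrier[OF _ detG] G by simp
    then have "A * G\<^sup>T * mat_inv (G * G\<^sup>T) * G = A * (G\<^sup>T * mat_inv (G * G\<^sup>T) * G)"
      using C by (simp add: A mat_assoc dims)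
    also have "\<dots> = C * (W t * (X * Y\<^sup>T) * Y)" using C by (simp add: A K'(4) mat_assoc dims)
    finally show ?thesis
      using whiten_mult[OF C WSY YV] \<Lambda> by (simp add: WSY_right XY)
  qed
  \<comment> \<open>The return to the first view contributes \<open>S\<^sup>T\<close>. The
    recurrence replaces \<open>W t * S * S\<^sup>T\<close> by \<open>W (Suc t)\<close>, and its
    factor \<open>\<Lambda> * \<Lambda>\<close> goes into the coefficient.\<close>
  have A_step: "\<exists>C'. C' \<in> carrier_mat L L \<and> det C' \<noteq> 0 \<and>
      whiten (B * F\<^sup>T * mat_inv (F * F\<^sup>T) * F) = C' * (W (Suc t) * X)"
    if C: "C \<in> carrier_mat L L" "det C \<noteq> 0" and B: "B = C * (W t * S * Y)" for B C t
  proof -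
    have "mat_inv (F * F\<^sup>T) \<in> carrier_mat dx dx" using mat_inv_carrier[OF _ detF] F by simp
    then have "B * F\<^sup>T * mat_inv (F * F\<^sup>T) * F = B * (F\<^sup>T * mat_inv (F * F\<^sup>T) * F)"
      using C by (simp add: B mat_assoc dims)
    also have "\<dots> = C * (W t * S * (Y * X\<^sup>T) * X)" using C by (simp add: B K(4) mat_assoc dims)
    also have "\<dots> = C * (\<Lambda> * \<Lambda>) * (W (Suc t) * X)"
      unfolding YX WSS using C by (simp add: mat_assoc dims)
    finally show ?thesis
      using whiten_mult[of "C * (\<Lambda> * \<Lambda>)", OF _ _ WX XU] C \<Lambda>
        det_mult[OF C(1), of "\<Lambda> * \<Lambda>"] det_mult[OF \<Lambda>(1) \<Lambda>(1)] by (simp add: WX_right)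
  qed
  have A: "\<exists>C. C \<in> carrier_mat L L \<and> det C \<noteq> 0 \<and> fst (als F G U0 t) = C * (W t * X)" for t
  proof (induction t)
    case 0
    have "fst (als F G U0 0) = U0\<^sup>T * X" by (simp add: Let_def X_def K_def[symmetric] mat_assoc dims)
    also have "\<dots> = U0\<^sup>T * U * (W 0 * X)" by (subst W0) (simp add: mat_assoc dims)
    finally show ?case
      using \<open>det (U0\<^sup>T * U) \<noteq> 0\<close> U0 U by (intro exI[of _ "U0\<^sup>T * U"]) auto
  next
    case (Suc t)
    then obtain C where "C \<in> carrier_mat L L" "det C \<noteq> 0" "fst (als F G U0 t) = C * (W t * X)"
      by blast
    from B_step[OF this] obtain C' where "C' \<in> carrier_mat L L" "det C' \<noteq> 0"
      "whiten (fst (als F G U0 t) * G\<^sup>T * mat_inv (G * G\<^sup>T) * G) = C' * (W t * S * Y)" by blast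
    from A_step[OF this] show ?case by (simp add: Let_def)
  qed
  \<comment> \<open>The second component at \<open>Suc t\<close> is computed from the first one at
    \<open>t\<close>, so it pairs with \<open>W t\<close>.\<close>
  have B: "\<exists>C. C \<in> carrier_mat L L \<and> det C \<noteq> 0 \<and> snd (als F G U0 (Suc t)) = C * (W t * S * Y)" for t
    using A[of t] B_step by (auto simp: Let_def)
  have WX_gram: "det (W t * X * (W t * X)\<^sup>T) \<noteq> 0" for t
    using det_gram_nonzero[OF WX XU] by (simp add: WX_right)
  have WSY_gram: "det (W t * S * Y * (W t * S * Y)\<^sup>T) \<noteq> 0" for t
    using det_gram_nonzero[OF WSY YV] \<Lambda> by (simp add: WSY_right)
  have proj_A: "row_proj (fst (als F G U0 t)) = row_proj (W t * X)" for t
    using A[of t] row_proj_mult_left[OF _ _ WX WX_gram] by auto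
  have proj_B: "row_proj (snd (als F G U0 (Suc t))) = row_proj (W t * S * Y)" for t
    using B[of t] row_proj_mult_left[OF _ _ WSY WSY_gram] by auto

  have UU: "U\<^sup>T * U = 1\<^sub>m L" and VV: "V\<^sup>T * V = 1\<^sub>m L"
    using first_cols_orthonormal[OF P] first_cols_orthonormal[OF Q] L by (auto simp: U_def V_def)
  have UX: "U\<^sup>T * X \<in> carrier_mat L N" and VY: "V\<^sup>T * Y \<in> carrier_mat L N"
    and USY: "U\<^sup>T * S * Y \<in> carrier_mat L N" by (auto simp: dims)
  have "U\<^sup>T * X * (X\<^sup>T * U) = U\<^sup>T * (X * X\<^sup>T) * U" by (simp add: mat_assoc dims)
  then have UX_gram: "det (U\<^sup>T * X * (U\<^sup>T * X)\<^sup>T) \<noteq> 0"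
    using det_gram_nonzero[OF UX XU] U by (simp add: K(3) UU)
  have "V\<^sup>T * Y * (Y\<^sup>T * V) = V\<^sup>T * (Y * Y\<^sup>T) * V" by (simp add: mat_assoc dims)
  then have VY_right: "V\<^sup>T * Y * (Y\<^sup>T * V) = 1\<^sub>m L" using V by (simp add: K'(3) VV)
  then have VY_gram: "det (V\<^sup>T * Y * (V\<^sup>T * Y)\<^sup>T) \<noteq> 0"
    using det_gram_nonzero[OF VY YV] by simp
  \<comment> \<open>The limit of \<open>W t * S * Y\<close> is thus a nonsingular multiple of the
    second CCA projection and has the same row space.\<close>
  have USY_eq: "U\<^sup>T * S * Y = \<Lambda> * (V\<^sup>T * Y)" by (simp add: US mat_assoc dims)
  have "U\<^sup>T * S * Y * (Y\<^sup>T * V) = \<Lambda> * (V\<^sup>T * Y * (Y\<^sup>T * V))"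
    unfolding USY_eq by (simp add: mat_assoc dims)
  then have USY_gram: "det (U\<^sup>T * S * Y * (U\<^sup>T * S * Y)\<^sup>T) \<noteq> 0"
    using det_gram_nonzero[OF USY YV] \<Lambda> by (simp add: VY_right)

  have UT: "U\<^sup>T \<in> carrier_mat L dx" using U by simp
  have "mat_tendsto (\<lambda>t. row_proj (W t * X)) (row_proj (U\<^sup>T * X))"
    by (intro row_proj_tendsto[OF WX WX_gram UX UX_gram]
        mat_tendsto_mult[OF W UT lim X X mat_tendsto_const])
  moreover have "(K * U)\<^sup>T * F = U\<^sup>T * X" by (simp add: X_def transpose_mult_dims K(2) mat_assoc dims)
  ultimately have "mat_tendsto (\<lambda>t. row_proj (fst (als F G U0 t))) (row_proj ((K * U)\<^sup>T * F))"
    by (simp add: proj_A)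
  moreover have "mat_tendsto (\<lambda>t. row_proj (snd (als F G U0 t))) (row_proj ((K' * V)\<^sup>T * G))"
  proof -
    have WS: "W t * S \<in> carrier_mat L dy" "U\<^sup>T * S \<in> carrier_mat L dy" for t by (auto simp: dims)
    have "mat_tendsto (\<lambda>t. row_proj (W t * S * Y)) (row_proj (U\<^sup>T * S * Y))"
      by (intro row_proj_tendsto[OF WSY WSY_gram USY USY_gram]
          mat_tendsto_mult[OF WS mat_tendsto_mult[OF W UT lim S S mat_tendsto_const] Y Y mat_tendsto_const])
    moreover have "row_proj (U\<^sup>T * S * Y) = row_proj ((K' * V)\<^sup>T * G)"
      unfolding USY_eq row_proj_mult_left[OF \<Lambda> VY VY_gram]
      by (simp add: Y_def transpose_mult_dims K'(2) mat_assoc dims)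
    \<comment> \<open>The initial second component is a placeholder, so the limit is shown for the
      shifted sequence and transferred back.\<close>
    ultimately show ?thesis
      unfolding mat_tendsto_def proj_B[symmetric] by (auto intro: LIMSEQ_imp_Suc)
  qed
  ultimately show ?thesis unfolding K_def K'_def U_def V_def by blast
qed

end
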